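(* Let $D$ be a strongly convex domain in $\mathbb C^n$. Assume that the complex geodesic $f:\mathbb D\to D$ and its dual $h$ extend holomorphically through the boundary of $\mathbb D$. Then the corresponding Lempert left inverse $G$ to $f$ extends holomorphically through the boundary of $D$.
   Context: $\mathbb D$ is the open unit disc in $\mathbb C$. For $w,z\in\mathbb C^n$, $w\bullet z:=\sum_{j=1}^n w_jz_j$. For a holomorphic function $G$ on $D$, $G'(z)=(\partial G/\partial z_1(z),\ldots,\partial G/\partial z_n(z))$. Strongly convex is understood in the usual sense: $D$ is bounded with $C^2$ boundary and has a $C^2$ defining function whose real Hessian is positive definite on the real tangent space at each boundary point. A holomorphic map $f:\mathbb D\to D$ is a complex geodesic if there is a holomorphic function $G:D\to\mathbb D$ with $G(f(\lambda))=\lambda$ for all $\lambda\in\mathbb D$; any such $G$ is called a left inverse to $f$. A left inverse $G$ is called a Lempert left inverse if for every $\lambda\in\mathbb D$ the fiber $G^{-1}(\lambda)$ is the intersection of $D$ with a complex affine hyperplane of $\mathbb C^n$. A holomorphic map $h:\mathbb D\to\mathbb C^n$ is a dual to the complex geodesic $f$ if $h\in H^1(\mathbb D,\mathbb C^n)$ (Hardy space), $h\not\equiv0$, and $(z-f(G(z)))\bullet h(G(z))=0$ for all $z\in D$, where $G$ is a left inverse to $f$. In strongly convex domains the dual is regarded as uniquely determined up to a positive constant: up to such a constant $h(\lambda)=G'(f(\lambda))$, $\lambda\in\mathbb D$, and $f'\bullet h\equiv C>0$ on $\mathbb D$. The corresponding Lempert left inverse $G$ is the one determined by $h$: for $z\in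 D$, $G(z)$ is the only $\lambda\in\mathbb D$ with $(z-f(\lambda))\bullet h(\lambda)=0$. A holomorphic map on a domain $\Omega$ extends holomorphically through the boundary of $\Omega$ if for each $a\in\partial\Omega$ there are an open neighborhood $U$ of $a$ and a holomorphic map on $U$ that agrees with the given one on $U\cap\Omega$. *)

theory Defs
  imports "HOL-Complex_Analysis.Complex_Analysis"
begin

text \<open>
  Complex $n$-space is \<^typ>\<open>complex^'n\<close>. Maps are total functions; only their values on the
  stated domain matter.
\<close>

abbreviation unit_disc :: "complex set" where
  "unit_disc \<equiv> ball 0 1"

text \<open>Bilinear, not sesquilinear: no conjugation, unlike the inner product of the library.\<close>

definition cdot :: "complex^'n \<Rightarrow> complex^'n \<Rightarrow> complex" (infixl "\<odot>" 70) where
  "w \<odot> z = (\<Sum>j\<in>UNIV. w $ j * z $ j)"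

definition holomorphic_curve_on :: "(complex \<Rightarrow> complex^'n) \<Rightarrow> complex set \<Rightarrow> bool" where
  "holomorphic_curve_on f S \<longleftrightarrow> (\<forall>j. (\<lambda>z. f z $ j) holomorphic_on S)"

text \<open>Used for open \<open>S\<close> only: the Frechet derivative exists and is complex linear.\<close>

definition holomorphic_fun_on :: "(complex^'n \<Rightarrow> complex) \<Rightarrow> (complex^'n) set \<Rightarrow> bool" where
  "holomorphic_fun_on G S \<longleftrightarrow>
     (\<forall>z\<in>S. \<exists>L. (G has_derivative L) (at z) \<and> (\<forall>c v. L (c *s v) = c * L v))"

text \<open>The vector of complex partial derivatives.\<close>

definition cgrad :: "(complex^'n \<Rightarrow> complex) \<Rightarrow> complex^'n \<Rightarrow> complex^'n" where
  "cgrad G z = (\<chi> j. deriv (\<lambda>t. G (z + axis j t)) 0)"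

text \<open>
  The parameter \<open>hol\<close> is the notion of holomorphy on an open set that is appropriate to the
  type of \<open>g\<close> (\<^const>\<open>holomorphic_curve_on\<close> or \<^const>\<open>holomorphic_fun_on\<close>).
\<close>

definition extends_through_boundary ::
    "(('a::topological_space \<Rightarrow> 'b) \<Rightarrow> 'a set \<Rightarrow> bool) \<Rightarrow> 'a set \<Rightarrow> ('a \<Rightarrow> 'b) \<Rightarrow> bool" where
  "extends_through_boundary hol \<Omega> g \<longleftrightarrow>
     (\<forall>a\<in>frontier \<Omega>. \<exists>U k. open U \<and> a \<in> U \<and> hol k U \<and> (\<forall>z\<in>U \<inter> \<Omega>. k z = g z))"

text \<open>
  \<open>r\<close> is a \<open>C\<^sup>2\<close> defining function of \<open>D\<close> on the neighbourhood \<open>U\<close> of the boundary, with first and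
  second real derivatives \<open>r'\<close> and \<open>r''\<close>.
\<close>

definition C2_defining_function ::
    "('a::euclidean_space) set \<Rightarrow> 'a set \<Rightarrow> ('a \<Rightarrow> real) \<Rightarrow> ('a \<Rightarrow> 'a \<Rightarrow>\<^sub>L real)
      \<Rightarrow> ('a \<Rightarrow> 'a \<Rightarrow>\<^sub>L 'a \<Rightarrow>\<^sub>L real) \<Rightarrow> bool" where
  "C2_defining_function D U r r' r'' \<longleftrightarrow>
     open U \<and> frontier D \<subseteq> U \<and>
     (\<forall>x\<in>U. (r has_derivative blinfun_apply (r' x)) (at x)) \<and>
     (\<forall>x\<in>U. (r' has_derivative blinfun_apply (r'' x)) (at x)) \<and>
     continuous_on U r'' \<and>
     D \<inter> U = {x\<in>U. r x < 0} \<and>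
     frontier D = {x\<in>U. r x = 0} \<and>
     (\<forall>a\<in>frontier D. r' a \<noteq> 0)"

text \<open>
  The kernel of \<open>r' a\<close> is the real tangent space to the boundary at \<open>a\<close>, and \<open>r'' a\<close> is the
  real Hessian.
\<close>

definition strongly_convex_domain :: "('a::euclidean_space) set \<Rightarrow> bool" where
  "strongly_convex_domain D \<longleftrightarrow>
     open D \<and> connected D \<and> D \<noteq> {} \<and> bounded D \<and>
     (\<exists>U r r' r''. C2_defining_function D U r r' r'' \<and>
        (\<forall>a\<in>frontier D. \<forall>v. v \<noteq> 0 \<longrightarrow> r' a v = 0 \<longrightarrow> r'' a v v > 0))"

definition left_inverse_to ::
    "(complex^'n) set \<Rightarrow> (complex \<Rightarrow> complex^'n) \<Rightarrow> (complex^'n \<Rightarrow> complex) \<Rightarrow> bool" where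
  "left_inverse_to D f G \<longleftrightarrow>
     holomorphic_fun_on G D \<and> G ` D \<subseteq> unit_disc \<and> (\<forall>\<zeta>\<in>unit_disc. G (f \<zeta>) = \<zeta>)"

definition complex_geodesic :: "(complex^'n) set \<Rightarrow> (complex \<Rightarrow> complex^'n) \<Rightarrow> bool" where
  "complex_geodesic D f \<longleftrightarrow>
     holomorphic_curve_on f unit_disc \<and> f ` unit_disc \<subseteq> D \<and> (\<exists>G. left_inverse_to D f G)"

definition complex_affine_hyperplane :: "(complex^'n) set \<Rightarrow> bool" where
  "complex_affine_hyperplane H \<longleftrightarrow> (\<exists>w b. w \<noteq> 0 \<and> H = {z. w \<odot> z = b})"

definition Lempert_left_inverse ::
    "(complex^'n) set \<Rightarrow> (complex \<Rightarrow> complex^'n) \<Rightarrow> (complex^'n \<Rightarrow> complex) \<Rightarrow> bool" where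
  "Lempert_left_inverse D f G \<longleftrightarrow>
     left_inverse_to D f G \<and>
     (\<forall>\<zeta>\<in>unit_disc. \<exists>H. complex_affine_hyperplane H \<and> {z\<in>D. G z = \<zeta>} = D \<inter> H)"

definition Hardy1 :: "(complex \<Rightarrow> complex^'n) \<Rightarrow> bool" where
  "Hardy1 h \<longleftrightarrow> holomorphic_curve_on h unit_disc \<and>
     bdd_above ((\<lambda>\<rho>. 1 / (2 * pi) * integral {0..2 * pi} (\<lambda>t. norm (h (rcis \<rho> t)))) ` {0..<1})"

definition dual_via ::
    "(complex^'n) set \<Rightarrow> (complex \<Rightarrow> complex^'n) \<Rightarrow> (complex^'n \<Rightarrow> complex)
      \<Rightarrow> (complex \<Rightarrow> complex^'n) \<Rightarrow> bool" where
  "dual_via D f G h \<longleftrightarrow>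
     Hardy1 h \<and> (\<exists>\<zeta>\<in>unit_disc. h \<zeta> \<noteq> 0) \<and>
     left_inverse_to D f G \<and> (\<forall>z\<in>D. (z - f (G z)) \<odot> h (G z) = 0)"

text \<open>
  The conditions of \<^const>\<open>dual_via\<close> are stable under multiplying \<open>h\<close> by, say, a bounded zero-free
  holomorphic function. The dual that is unique up to a positive constant is singled out by
  \<open>h = C G' \<circ> f\<close> with a constant \<open>C > 0\<close>; since \<open>G \<circ> f\<close> is the identity of the disc, the chain
  rule turns this into \<open>f' \<odot> h \<equiv> C\<close>.
\<close>

definition normalized_dual ::
    "(complex^'n) set \<Rightarrow> (complex \<Rightarrow> complex^'n) \<Rightarrow> (complex \<Rightarrow> complex^'n) \<Rightarrow> bool" where
  "normalized_dual D f h \<longleftrightarrow>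
     (\<exists>G. dual_via D f G h \<and>
        (\<exists>C>0. \<forall>\<zeta>\<in>unit_disc. h \<zeta> = C *\<^sub>R cgrad G (f \<zeta>)))"

text \<open>The Lempert left inverse determined by \<open>h\<close>; the last condition fixes \<open>G\<close> on \<open>D\<close>.\<close>

definition corresponding_Lempert_left_inverse ::
    "(complex^'n) set \<Rightarrow> (complex \<Rightarrow> complex^'n) \<Rightarrow> (complex \<Rightarrow> complex^'n)
      \<Rightarrow> (complex^'n \<Rightarrow> complex) \<Rightarrow> bool" where
  "corresponding_Lempert_left_inverse D f h G \<longleftrightarrow>
     Lempert_left_inverse D f G \<and>
     (\<forall>z\<in>D. \<forall>\<zeta>\<in>unit_disc. (z - f \<zeta>) \<odot> h \<zeta> = 0 \<longleftrightarrow> \<zeta> = G z)"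

end

theory Submission
  imports Defs
begin

text \<open>
  Put \<open>F(z, \<zeta>) = (z - f \<zeta>) \<odot> h \<zeta>\<close>. For \<open>z\<close> in \<open>D\<close> the number \<open>G z\<close> is the only zero of \<open>F(z, \<cdot>)\<close> in the
  disc, so \<open>G\<close> is an implicit function, and it continues holomorphically past a boundary point
  \<open>a\<close> as soon as \<open>G\<close> clusters at \<open>a\<close> at a simple zero of \<open>F(a, \<cdot>)\<close>, where \<open>f\<close> and \<open>h\<close> are
  replaced by their holomorphic extensions if the zero lies on the unit circle. The points are thus to
  exclude multiple zeros and to see that the implicit function really is \<open>G\<close> on all of \<open>D\<close> near \<open>a\<close>.

  Both rest on one fact: \<open>F(z, \<cdot>)\<close> has no zero on the circle when \<open>z\<close> is in \<open>D\<close>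
  (\<open>no_zero_on_circle\<close>). For \<open>\<zeta>\<close> in the disc near a zero \<open>\<zeta>\<^sub>0\<close> on the circle, a small
  translation of \<open>z\<close> in a fixed direction turns \<open>\<zeta>\<close> into a zero; then \<open>G\<close> takes the value \<open>\<zeta>\<close> near
  \<open>z\<close>, and letting \<open>\<zeta>\<close> tend to \<open>\<zeta>\<^sub>0\<close> contradicts the continuity of \<open>G\<close> at \<open>z\<close>.

  Since \<open>F(\<cdot>, \<zeta>)\<close> is affine and \<open>D\<close> is strictly convex, it follows that for \<open>a\<close> in the closure of
  \<open>D\<close> a zero \<open>\<zeta>\<close> on the circle forces \<open>a = f \<zeta>\<close> (\<open>circle_zero_is_curve_point\<close>), and there
  \<open>\<partial>F/\<partial>\<zeta> = - f' \<odot> h = - C \<noteq> 0\<close>. A multiple zero \<open>\<zeta>\<^sub>0\<close> in the open disc is impossible as well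
  (\<open>interior_zero_simple\<close>): on the segment from \<open>f \<zeta>\<^sub>0\<close> to \<open>a\<close>, which runs in \<open>D\<close> up to its end, it
  would split off a second zero, against uniqueness.

  Finally, if \<open>g\<close> is the implicit function near \<open>a\<close>, then \<open>g\<close> omits the circle on the connected
  set \<open>D \<inter> ball a e\<close> and takes there a value in the disc, so it stays in the disc and equals \<open>G\<close>
  (\<open>left_inverse_extends\<close>).
\<close>

section \<open>Strict convexity of strongly convex domains\<close>

text \<open>
  The infinitesimal form of strict convexity: at a contact point the segment would be tangent to the
  boundary, and the positive Hessian would push it out of the closure on both sides. Convexity of
  \<open>D\<close> follows from this by connectedness.
\<close>

lemma no_interior_boundary_contact:
  fixes D :: "'a::euclidean_space set"
  assumes D: "strongly_convex_domain D" and xy: "x \<noteq> y"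
    and seg: "closed_segment x y \<subseteq> closure D"
  shows "open_segment x y \<inter> frontier D = {}"
proof (rule ccontr)
  assume "open_segment x y \<inter> frontier D \<noteq> {}"
  then obtain a where a: "a \<in> open_segment x y" "a \<in> frontier D" by blast
  then obtain s where s: "0 < s" "s < 1" "a = (1 - s) *\<^sub>R x + s *\<^sub>R y"
    by (auto simp: in_segment)
  define v where "v = y - x"
  have v: "v \<noteq> 0" using xy by (simp add: v_def)
  obtain U r r' r'' where C2: "C2_defining_function D U r r' r''"
    and pos: "\<And>b w. b \<in> frontier D \<Longrightarrow> w \<noteq> 0 \<Longrightarrow> r' b w = 0 \<Longrightarrow> r'' b w w > 0"
    using D unfolding strongly_convex_domain_def by blast
  have U: "open U" "a \<in> U" and r0: "r a = 0"
    and dr: "\<And>b. b \<in> U \<Longrightarrow> (r has_derivative blinfun_apply (r' b)) (at b)"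
    and dr': "\<And>b. b \<in> U \<Longrightarrow> (r' has_derivative blinfun_apply (r'' b)) (at b)"
    and neg: "D \<inter> U = {b\<in>U. r b < 0}" and zero: "frontier D = {b\<in>U. r b = 0}"
    using C2 a(2) by (auto simp: C2_defining_function_def)
  define \<gamma> where "\<gamma> = (\<lambda>t::real. a + t *\<^sub>R v)"
  have d\<gamma>: "(\<gamma> has_derivative (\<lambda>t. t *\<^sub>R v)) (at t)" for t
    unfolding \<gamma>_def by (auto intro!: derivative_eq_intros)
  have d1: "((\<lambda>t. r (\<gamma> t)) has_real_derivative r' (\<gamma> t) v) (at t)" if "\<gamma> t \<in> U" for t
    using diff_chain_at[OF d\<gamma> dr[OF that]]
    by (simp add: has_field_derivative_def o_def blinfun.scaleR_right mult_commute_abs)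
  have d2: "((\<lambda>t. r' (\<gamma> t) v) has_real_derivative r'' (\<gamma> t) v v) (at t)" if "\<gamma> t \<in> U" for t
  proof -
    have "((\<lambda>t. r' (\<gamma> t)) has_derivative (\<lambda>t'. r'' (\<gamma> t) (t' *\<^sub>R v))) (at t)"
      using diff_chain_at[OF d\<gamma> dr'[OF that]] by (simp add: o_def)
    then have "((\<lambda>t. r' (\<gamma> t) v) has_derivative (\<lambda>t'. r'' (\<gamma> t) (t' *\<^sub>R v) v)) (at t)"
      by (rule bounded_linear.has_derivative[OF blinfun.bounded_linear_left])
    then show ?thesis
      by (simp add: has_field_derivative_def blinfun.scaleR_right blinfun.scaleR_left mult_commute_abs)
  qed
  have "open (\<gamma> -` U)"
    using U(1) by (intro open_vimage) (auto simp: \<gamma>_def intro!: continuous_intros)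
  moreover have "0 \<in> \<gamma> -` U" using U by (simp add: \<gamma>_def)
  ultimately obtain e0 where e0: "e0 > 0" "ball 0 e0 \<subseteq> \<gamma> -` U"
    by (meson openE)
  define e where "e = Min {e0, s, 1 - s}"
  have e: "e > 0" "e \<le> e0" "e \<le> s" "e \<le> 1 - s" using e0 s by (auto simp: e_def)
  have inU: "\<gamma> t \<in> U" if "\<bar>t\<bar> < e" for t
    using e0 e that by (auto simp: dist_norm subset_iff)
  have le0: "r (\<gamma> t) \<le> 0" if "\<bar>t\<bar> < e" for t
  proof -
    have "\<gamma> t = (1 - (s + t)) *\<^sub>R x + (s + t) *\<^sub>R y"
      by (simp add: \<gamma>_def s v_def algebra_simps)
    then have "\<gamma> t \<in> closed_segment x y"
      using that e unfolding in_segment by (intro exI[of _ "s + t"]) auto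
    then have "\<gamma> t \<in> D \<union> frontier D" using seg closure_Un_frontier by blast
    moreover have "r (\<gamma> t) < 0" if "\<gamma> t \<in> D"
      using neg that inU[OF \<open>\<bar>t\<bar> < e\<close>] by blast
    ultimately show ?thesis using zero by auto
  qed
  have \<gamma>0: "\<gamma> 0 = a" by (simp add: \<gamma>_def)
  \<comment> \<open>The segment stays in the closure, so \<open>r\<close> restricted to it is maximal at \<open>a\<close>; a maximum
     is incompatible with a vanishing first and a positive second derivative.\<close>
  have tangent: "r' a v = 0"
    using DERIV_local_max[OF d1[of 0] e(1)] le0 U r0 by (simp add: \<gamma>0)
  obtain d where d: "d > 0" "\<And>h. h > 0 \<Longrightarrow> h < d \<Longrightarrow> r' (\<gamma> h) v > 0"
    using has_real_derivative_pos_inc_right[OF d2[of 0]] pos[OF a(2) v tangent] U tangent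
    by (auto simp: \<gamma>0)
  define h where "h = min d e / 2"
  have h: "h > 0" "h < d" "h < e" using d e by (auto simp: h_def)
  obtain z where "0 < z" "z < h" "r (\<gamma> h) - r (\<gamma> 0) = (h - 0) * r' (\<gamma> z) v"
    using MVT2[OF h(1), of "\<lambda>t. r (\<gamma> t)" "\<lambda>t. r' (\<gamma> t) v"] d1 inU h by fastforce
  then have "r (\<gamma> h) > 0" using d h r0 by (simp add: \<gamma>0)
  then show False using le0[of h] h by simp
qed

lemma segment_in_closure_imp_in_domain:
  fixes D :: "'a::euclidean_space set"
  assumes D: "strongly_convex_domain D" and "x \<in> D" "y \<in> D"
    and seg: "closed_segment x y \<subseteq> closure D"
  shows "closed_segment x y \<subseteq> D"
proof (cases "x = y")
  case False
  have "open D" using D by (simp add: strongly_convex_domain_def)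
  then have disj: "D \<inter> frontier D = {}" by (simp add: frontier_def interior_open)
  have "closed_segment x y \<inter> frontier D = {}"
    using no_interior_boundary_contact[OF D False seg] assms(2,3) disj
    unfolding open_segment_def by blast
  then show ?thesis using seg closure_Un_frontier[of D] by blast
qed (use assms in simp)

lemma open_segments_inside:
  fixes D :: "'a::euclidean_space set"
  assumes "open D"
  shows "open {p. closed_segment (fst p) (snd p) \<subseteq> D}"
proof (rule openI)
  fix p :: "'a \<times> 'a" assume "p \<in> {p. closed_segment (fst p) (snd p) \<subseteq> D}"
  then have sub: "closed_segment (fst p) (snd p) \<subseteq> D" by simp
  obtain e where e: "e > 0" "(\<Union>x\<in>closed_segment (fst p) (snd p). ball x e) \<subseteq> D"
    using compact_subset_open_imp_ball_epsilon_subset[OF compact_segment assms sub] by blast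
  have "closed_segment (fst q) (snd q) \<subseteq> D" if q: "dist p q < e" for q
  proof
    fix z assume "z \<in> closed_segment (fst q) (snd q)"
    then obtain t where t: "0 \<le> t" "t \<le> 1" "z = (1 - t) *\<^sub>R fst q + t *\<^sub>R snd q"
      by (auto simp: in_segment)
    let ?w = "(1 - t) *\<^sub>R fst p + t *\<^sub>R snd p"
    have "dist (fst p) (fst q) < e" "dist (snd p) (snd q) < e"
      using q dist_fst_le[of p q] dist_snd_le[of p q] by auto
    then have nn: "fst q \<in> ball (fst p) e" "snd q \<in> ball (snd p) e" by auto
    have "?w - z = (1 - t) *\<^sub>R (fst p - fst q) + t *\<^sub>R (snd p - snd q)"
      by (simp add: t algebra_simps)
    moreover have "(1 - t) *\<^sub>R (fst p - fst q) + t *\<^sub>R (snd p - snd q) \<in> ball 0 e"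
      using t nn by (intro convexD) (auto simp: dist_norm norm_minus_commute)
    ultimately have "?w - z \<in> ball 0 e" by metis
    then have "z \<in> ball ?w e" by (simp only: mem_ball dist_norm diff_0 norm_minus_cancel)
    moreover have "?w \<in> closed_segment (fst p) (snd p)"
      using t by (auto simp: in_segment)
    ultimately show "z \<in> D" using e(2) by blast
  qed
  then have "ball p e \<subseteq> {p. closed_segment (fst p) (snd p) \<subseteq> D}"
    unfolding subset_iff mem_ball mem_Collect_eq by blast
  then show "\<exists>e>0. ball p e \<subseteq> {p. closed_segment (fst p) (snd p) \<subseteq> D}"
    using e(1) by blast
qed

lemma closed_segments_inside:
  fixes C :: "'a::real_normed_vector set"
  assumes "closed C"
  shows "closed {p. closed_segment (fst p) (snd p) \<subseteq> C}"
proof -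
  have "{p. closed_segment (fst p) (snd p) \<subseteq> C} =
     (\<Inter>t\<in>{0..1}. (\<lambda>p. (1 - t) *\<^sub>R fst p + t *\<^sub>R snd p) -` C)"
    by (force simp: in_segment)
  moreover have "closed ((\<lambda>p. (1 - t) *\<^sub>R fst p + t *\<^sub>R snd p) -` C)" for t :: real
    by (intro closed_vimage assms continuous_intros)
  ultimately show ?thesis by auto
qed

text \<open>
  From local to global: the pairs of points of \<open>D\<close> that see each other inside \<open>D\<close> form an open subset
  of \<open>D \<times> D\<close>. It is also closed, because a limit of segments in \<open>D\<close> lies in the closure of \<open>D\<close> and so
  cannot touch the boundary. As \<open>D \<times> D\<close> is connected, all pairs see each other.
\<close>

lemma strongly_convex_domain_convex:
  fixes D :: "'a::euclidean_space set"
  assumes D: "strongly_convex_domain D"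
  shows "convex D"
proof -
  have op: "open D" and conn: "connected D" and ne: "D \<noteq> {}"
    using D by (auto simp: strongly_convex_domain_def)
  define S where "S = D \<times> D \<inter> {p. closed_segment (fst p) (snd p) \<subseteq> D}"
  have S': "S = D \<times> D \<inter> {p. closed_segment (fst p) (snd p) \<subseteq> closure D}"
    using segment_in_closure_imp_in_domain[OF D] closure_subset[of D]
    by (fastforce simp: S_def)
  have "openin (top_of_set (D \<times> D)) S"
    unfolding S_def using open_segments_inside[OF op] by (rule openin_open_Int)
  moreover have "closedin (top_of_set (D \<times> D)) S"
    unfolding S' using closed_segments_inside[OF closed_closure] by (rule closedin_closed_Int)
  moreover obtain x where "x \<in> D" using ne by blast
  then have "(x, x) \<in> S" by (simp add: S_def)
  ultimately have "S = D \<times> D"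
    using connected_Times[OF conn conn] by (auto simp: connected_clopen)
  then have "(x, y) \<in> S" if "x \<in> D" "y \<in> D" for x y
    using that by simp
  then have "closed_segment x y \<subseteq> D" if "x \<in> D" "y \<in> D" for x y
    using that by (fastforce simp: S_def)
  then show ?thesis by (simp add: convex_contains_segment)
qed

lemma strongly_convex_domain_strictly_convex:
  fixes D :: "'a::euclidean_space set"
  assumes D: "strongly_convex_domain D" and "x \<in> closure D" "y \<in> closure D" "x \<noteq> y"
  shows "open_segment x y \<subseteq> D"
proof -
  have "convex (closure D)" using strongly_convex_domain_convex[OF D] by (rule convex_closure)
  then have seg: "closed_segment x y \<subseteq> closure D"
    using assms(2,3) by (simp add: closed_segment_subset)
  show ?thesis
    using no_interior_boundary_contact[OF D \<open>x \<noteq> y\<close> seg] seg closure_Un_frontier[of D]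
      segment_open_subset_closed[of x y] by blast
qed

section \<open>Holomorphic curves and the bilinear product\<close>

lemma cdot_zero_right [simp]: "w \<odot> 0 = 0" and cdot_zero_left [simp]: "0 \<odot> w = 0"
  by (simp_all add: cdot_def)

lemma cdot_diff_left: "(w - v) \<odot> z = w \<odot> z - v \<odot> z"
  by (simp add: cdot_def left_diff_distrib sum_subtractf)

lemma cdot_add_left: "(w + v) \<odot> z = w \<odot> z + v \<odot> z"
  by (simp add: cdot_def distrib_right sum.distrib)

lemma cdot_smult_left: "(c *s w) \<odot> z = c * (w \<odot> z)"
  by (simp add: cdot_def sum_distrib_left mult.assoc)

lemma cdot_scaleR_left: "(c *\<^sub>R w) \<odot> z = c *\<^sub>R (w \<odot> z)"
  by (simp add: cdot_def scaleR_sum_right)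

lemma cdot_scaleR_right: "w \<odot> (c *\<^sub>R z) = c *\<^sub>R (w \<odot> z)"
  by (simp add: cdot_def scaleR_sum_right)

lemma bounded_bilinear_cdot: "bounded_bilinear (\<odot>)"
proof -
  have "bilinear (\<odot>)"
    unfolding bilinear_def cdot_def
    by (auto intro!: linearI simp: sum.distrib ring_distribs scaleR_sum_right)
  then show ?thesis by (simp add: bilinear_conv_bounded_bilinear)
qed

lemmas continuous_on_cdot [continuous_intros] = bounded_bilinear.continuous_on[OF bounded_bilinear_cdot]
  and tendsto_cdot [tendsto_intros] = bounded_bilinear.tendsto[OF bounded_bilinear_cdot]

definition curve_deriv :: "(complex \<Rightarrow> complex^'n) \<Rightarrow> complex \<Rightarrow> complex^'n" where
  "curve_deriv f \<zeta> = (\<chi> j. deriv (\<lambda>z. f z $ j) \<zeta>)"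

lemma holomorphic_curve_on_imp_continuous_on:
  "holomorphic_curve_on f S \<Longrightarrow> continuous_on S f"
  using continuous_on_vec_lambda[of S "\<lambda>j z. f z $ j"]
  by (simp add: holomorphic_curve_on_def holomorphic_on_imp_continuous_on)

lemma holomorphic_curve_on_curve_deriv:
  "holomorphic_curve_on f S \<Longrightarrow> open S \<Longrightarrow> holomorphic_curve_on (curve_deriv f) S"
  by (simp add: holomorphic_curve_on_def curve_deriv_def holomorphic_deriv)

lemma holomorphic_on_cdot:
  "holomorphic_curve_on f S \<Longrightarrow> holomorphic_curve_on h S \<Longrightarrow> (\<lambda>\<zeta>. f \<zeta> \<odot> h \<zeta>) holomorphic_on S"
  unfolding holomorphic_curve_on_def cdot_def by (intro holomorphic_intros) auto

lemma holomorphic_curve_on_const: "holomorphic_curve_on (\<lambda>\<zeta>. w) S"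
  by (simp add: holomorphic_curve_on_def)

lemma holomorphic_curve_on_diff:
  "holomorphic_curve_on f S \<Longrightarrow> holomorphic_curve_on h S \<Longrightarrow> holomorphic_curve_on (\<lambda>\<zeta>. f \<zeta> - h \<zeta>) S"
  by (simp add: holomorphic_curve_on_def holomorphic_on_diff)

lemma holomorphic_on_zero_equation:
  assumes "holomorphic_curve_on f S" "holomorphic_curve_on h S"
  shows "(\<lambda>\<zeta>. (z - f \<zeta>) \<odot> h \<zeta>) holomorphic_on S"
  using assms by (intro holomorphic_on_cdot holomorphic_curve_on_diff holomorphic_curve_on_const)

lemma has_field_derivative_cdot:
  assumes "holomorphic_curve_on f S" "holomorphic_curve_on h S" "open S" "\<zeta> \<in> S"
  shows "((\<lambda>\<zeta>. f \<zeta> \<odot> h \<zeta>) has_field_derivative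
    curve_deriv f \<zeta> \<odot> h \<zeta> + f \<zeta> \<odot> curve_deriv h \<zeta>) (at \<zeta>)"
proof -
  have d: "((\<lambda>\<zeta>. f \<zeta> $ j) has_field_derivative curve_deriv f \<zeta> $ j) (at \<zeta>)"
    "((\<lambda>\<zeta>. h \<zeta> $ j) has_field_derivative curve_deriv h \<zeta> $ j) (at \<zeta>)" for j
    using assms by (auto simp: holomorphic_curve_on_def curve_deriv_def intro: holomorphic_derivI)
  show ?thesis
    unfolding cdot_def
    by (auto intro!: derivative_eq_intros d simp: sum.distrib[symmetric] algebra_simps)
qed

lemma has_field_derivative_zero_equation:
  assumes "holomorphic_curve_on f S" "holomorphic_curve_on h S" "open S" "\<zeta> \<in> S"
  shows "((\<lambda>\<zeta>. (z - f \<zeta>) \<odot> h \<zeta>) has_field_derivative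
    (z - f \<zeta>) \<odot> curve_deriv h \<zeta> - curve_deriv f \<zeta> \<odot> h \<zeta>) (at \<zeta>)"
proof -
  have "curve_deriv (\<lambda>\<zeta>. z - f \<zeta>) \<zeta> = - curve_deriv f \<zeta>"
  proof -
    have "deriv (\<lambda>\<zeta>. (z - f \<zeta>) $ j) \<zeta> = - deriv (\<lambda>\<zeta>. f \<zeta> $ j) \<zeta>" for j
      using assms holomorphic_derivI[of "\<lambda>\<zeta>. f \<zeta> $ j" S \<zeta>]
      by (intro DERIV_imp_deriv) (auto simp: holomorphic_curve_on_def intro!: derivative_eq_intros)
    then show ?thesis by (simp add: curve_deriv_def vec_eq_iff)
  qed
  then show ?thesis
    using has_field_derivative_cdot[OF holomorphic_curve_on_diff[OF holomorphic_curve_on_const assms(1), of z] assms(2-4)]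
    by (simp add: cdot_diff_left[of 0, simplified])
qed

lemma complex_linear_eq_cdot:
  fixes L :: "complex^'n \<Rightarrow> complex"
  assumes "linear L" and "\<And>c v. L (c *s v) = c * L v"
  shows "L v = v \<odot> (\<chi> j. L (axis j 1))"
proof -
  have "L v = L (\<Sum>j\<in>UNIV. v $ j *s axis j 1)"
    by (simp add: basis_expansion)
  also have "\<dots> = (\<Sum>j\<in>UNIV. v $ j * L (axis j 1))"
    by (simp add: linear_sum[OF assms(1)] assms(2))
  finally show ?thesis by (simp add: cdot_def)
qed

lemma has_derivative_componentwise_vec:
  fixes f :: "'a::real_normed_vector \<Rightarrow> 'b::euclidean_space^'n"
  assumes "\<And>j. ((\<lambda>x. f x $ j) has_derivative (\<lambda>v. f' v $ j)) (at x)"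
  shows "(f has_derivative f') (at x)"
  by (subst has_derivative_componentwise_within)
    (auto simp: Basis_vec_def inner_axis intro!: has_derivative_inner_left assms)

text \<open>
  For a left inverse \<open>G\<close> of \<open>f\<close> this yields \<open>f' \<odot> G'(f) = 1\<close>, hence \<open>f' \<odot> h = C\<close> for the
  normalized dual.
\<close>

lemma chain_rule_cgrad:
  fixes f :: "complex \<Rightarrow> complex^'n"
  assumes f: "holomorphic_curve_on f S" "open S" "\<zeta> \<in> S"
    and G: "holomorphic_fun_on G D" "f \<zeta> \<in> D"
  shows "((\<lambda>\<zeta>. G (f \<zeta>)) has_field_derivative curve_deriv f \<zeta> \<odot> cgrad G (f \<zeta>)) (at \<zeta>)"
proof -
  obtain L where L: "(G has_derivative L) (at (f \<zeta>))" and lin: "\<And>c v. L (c *s v) = c * L v"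
    using G by (auto simp: holomorphic_fun_on_def)
  have "deriv (\<lambda>t. G (f \<zeta> + axis j t)) 0 = L (axis j 1)" for j
  proof (rule DERIV_imp_deriv)
    have "((\<lambda>t. f \<zeta> + axis j t) has_derivative axis j) (at 0)"
    proof (rule has_derivative_componentwise_vec)
      show "((\<lambda>t. (f \<zeta> + axis j t) $ i) has_derivative (\<lambda>t. axis j t $ i)) (at 0)" for i
        by (cases "i = j") (auto simp: axis_def intro!: derivative_eq_intros)
    qed
    then have "((\<lambda>t. G (f \<zeta> + axis j t)) has_derivative (\<lambda>t. L (axis j t))) (at 0)"
      by (rule has_derivative_compose) (simp add: L axis_eq_0_iff[THEN iffD2])
    moreover have "(\<lambda>t. L (axis j t)) = (*) (L (axis j 1))"
    proof
      fix t :: complex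
      have ax: "axis j t = t *s axis j 1" by (simp add: vec_eq_iff axis_def)
      show "L (axis j t) = L (axis j 1) * t"
        using lin[of t "axis j 1"] unfolding ax[symmetric] by (simp only: mult.commute)
    qed
    ultimately show "((\<lambda>t. G (f \<zeta> + axis j t)) has_field_derivative L (axis j 1)) (at 0)"
      by (simp only: has_field_derivative_def)
  qed
  then have grad: "L v = v \<odot> cgrad G (f \<zeta>)" for v
    using complex_linear_eq_cdot[of L, OF has_derivative_linear[OF L] lin, of v] by (simp add: cgrad_def)
  have "((\<lambda>\<zeta>. f \<zeta> $ j) has_derivative (\<lambda>\<mu>. (\<mu> *s curve_deriv f \<zeta>) $ j)) (at \<zeta>)" for j
    using f holomorphic_derivI[of "\<lambda>\<zeta>. f \<zeta> $ j" S \<zeta>]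
    by (simp add: holomorphic_curve_on_def curve_deriv_def has_field_derivative_def mult_commute_abs)
  then have "(f has_derivative (\<lambda>\<mu>. \<mu> *s curve_deriv f \<zeta>)) (at \<zeta>)"
    by (rule has_derivative_componentwise_vec)
  from has_derivative_compose[OF this L]
  show ?thesis by (simp add: has_field_derivative_def grad cdot_smult_left mult_commute_abs)
qed

section \<open>The holomorphic implicit function\<close>

lemma snd_inv_complex_linear:
  fixes L :: "(complex^'n) \<times> complex \<Rightarrow> (complex^'n) \<times> complex"
  assumes "bij L" and "\<And>c v \<mu>. L (c *s v, c * \<mu>) = (c *s fst (L (v, \<mu>)), c * snd (L (v, \<mu>)))"
  shows "snd (inv L (c *s v, 0)) = c * snd (inv L (v, 0))"
proof -
  obtain w \<mu> where w: "inv L (v, 0) = (w, \<mu>)" by fastforce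
  then have "L (w, \<mu>) = (v, 0)" using assms(1) by (metis bij_inv_eq_iff)
  then have "L (c *s w, c * \<mu>) = (c *s v, 0)" by (simp add: assms(2))
  then have "inv L (c *s v, 0) = (c *s w, c * \<mu>)"
    using assms(1) by (metis bij_inv_eq_iff)
  then show ?thesis by (simp add: w)
qed

text \<open>
  The holomorphic implicit function theorem for \<open>F(z, \<zeta>) = (z - k \<zeta>) \<odot> l \<zeta>\<close>, obtained from the real
  inverse function theorem for \<open>(z, \<zeta>) \<mapsto> (z, F(z, \<zeta>))\<close>. The derivative of this map is complex
  linear, and so is that of the inverse, which gives the holomorphy of the implicit function.
\<close>

lemma implicit_zero_holomorphic:
  fixes k l :: "complex \<Rightarrow> complex^'n"
  assumes U: "open U" "\<zeta>0 \<in> U"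
    and kl: "holomorphic_curve_on k U" "holomorphic_curve_on l U"
    and zero: "(a - k \<zeta>0) \<odot> l \<zeta>0 = 0"
    and simple: "(a - k \<zeta>0) \<odot> curve_deriv l \<zeta>0 - curve_deriv k \<zeta>0 \<odot> l \<zeta>0 \<noteq> 0"
  obtains W V g where "open W" "a \<in> W" "open V" "\<zeta>0 \<in> V" "V \<subseteq> U"
    "holomorphic_fun_on g W" "\<And>z. z \<in> W \<Longrightarrow> g z \<in> V"
    "\<And>z \<zeta>. z \<in> W \<Longrightarrow> \<zeta> \<in> V \<Longrightarrow> (z - k \<zeta>) \<odot> l \<zeta> = 0 \<longleftrightarrow> \<zeta> = g z"
proof -
  define F where "F = (\<lambda>(z::complex^'n) \<zeta>. (z - k \<zeta>) \<odot> l \<zeta>)"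
  define F' where "F' = (\<lambda>(z::complex^'n) \<zeta>. (z - k \<zeta>) \<odot> curve_deriv l \<zeta> - curve_deriv k \<zeta> \<odot> l \<zeta>)"
  define \<Phi> where "\<Phi> = (\<lambda>p::(complex^'n) \<times> complex. (fst p, F (fst p) (snd p)))"
  define d where "d = (\<lambda>p q::(complex^'n) \<times> complex. (fst q, fst q \<odot> l (snd p) + snd q * F' (fst p) (snd p)))"
  have bl: "bounded_linear (d p)" for p
    unfolding d_def
    by (intro bounded_linear_Pair bounded_linear_add bounded_linear_fst
        bounded_linear_compose[OF bounded_bilinear.bounded_linear_left[OF bounded_bilinear_cdot]]
        bounded_linear_compose[OF bounded_linear_mult_left] bounded_linear_snd)
  have cont: "continuous_on U k" "continuous_on U l" "continuous_on U (curve_deriv k)" "continuous_on U (curve_deriv l)"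
    using kl U holomorphic_curve_on_curve_deriv holomorphic_curve_on_imp_continuous_on by blast+
  have d\<Phi>: "(\<Phi> has_derivative Blinfun (d p)) (at p)" if "p \<in> UNIV \<times> U" for p
  proof -
    obtain z \<zeta> where p: "p = (z, \<zeta>)" and \<zeta>: "\<zeta> \<in> U" using \<open>p \<in> UNIV \<times> U\<close> by (cases p) auto
    have component: "((\<lambda>p. m (snd p) $ j) has_derivative (\<lambda>q. snd q * curve_deriv m \<zeta> $ j)) (at p)"
      if "holomorphic_curve_on m U" for m j
    proof -
      have "((\<lambda>\<zeta>. m \<zeta> $ j) has_derivative (\<lambda>\<mu>. \<mu> * curve_deriv m \<zeta> $ j)) (at (snd p))"
        using that \<zeta> U p holomorphic_derivI[of "\<lambda>\<zeta>. m \<zeta> $ j" U \<zeta>]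
        by (simp add: holomorphic_curve_on_def curve_deriv_def has_field_derivative_def mult_commute_abs)
      then show ?thesis
        by (rule has_derivative_compose[OF has_derivative_snd[OF has_derivative_ident]])
    qed
    have coord: "((\<lambda>p::(complex^'n) \<times> complex. fst p $ j) has_derivative (\<lambda>q. fst q $ j)) (at p)" for j
      by (intro bounded_linear_imp_has_derivative bounded_linear_compose[OF bounded_linear_vec_nth] bounded_linear_fst)
    have "((\<lambda>p. F (fst p) (snd p)) has_derivative
        (\<lambda>q. \<Sum>j\<in>UNIV. (z $ j - k \<zeta> $ j) * (snd q * curve_deriv l \<zeta> $ j)
           + (fst q $ j - snd q * curve_deriv k \<zeta> $ j) * l \<zeta> $ j)) (at p)"
      unfolding F_def cdot_def vector_minus_component
      by (intro has_derivative_sum has_derivative_eq_rhs[OF has_derivative_mult[OF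
            has_derivative_diff[OF coord component[OF kl(1)]] component[OF kl(2)]]])
        (simp add: p)
    moreover have "(\<Sum>j\<in>UNIV. (z $ j - k \<zeta> $ j) * (snd q * curve_deriv l \<zeta> $ j)
           + (fst q $ j - snd q * curve_deriv k \<zeta> $ j) * l \<zeta> $ j)
        = fst q \<odot> l \<zeta> + snd q * F' z \<zeta>" for q
      by (simp add: F'_def cdot_def sum_distrib_left sum.distrib sum_subtractf algebra_simps)
    ultimately have "(\<Phi> has_derivative d p) (at p)"
      unfolding \<Phi>_def d_def by (simp add: p has_derivative_Pair bounded_linear_imp_has_derivative bounded_linear_fst)
    then show ?thesis by (simp add: bounded_linear_Blinfun_apply bl)
  qed
  have contd: "continuous_on (UNIV \<times> U) (\<lambda>p. Blinfun (d p))"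
  proof (rule continuous_on_blinfun_componentwise)
    fix i :: "(complex^'n) \<times> complex"
    have sub: "snd ` (UNIV \<times> U) \<subseteq> U" by auto
    note c = cont[THEN continuous_on_compose2[OF _ continuous_on_snd[OF continuous_on_id] sub]]
    show "continuous_on (UNIV \<times> U) (\<lambda>p. blinfun_apply (Blinfun (d p)) i)"
      unfolding bounded_linear_Blinfun_apply[OF bl] unfolding d_def F'_def
      by (intro continuous_intros c)
  qed
  define B where "B = F' a \<zeta>0"
  have B: "B \<noteq> 0" using simple by (simp add: B_def F'_def)
  \<comment> \<open>The inverse of the derivative at \<open>(a, \<zeta>0)\<close>: solve for the second component.\<close>
  define e where "e = (\<lambda>q::(complex^'n) \<times> complex. (fst q, (snd q - fst q \<odot> l \<zeta>0) * inverse B))"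
  have ble: "bounded_linear e"
    unfolding e_def
    by (intro bounded_linear_Pair bounded_linear_sub bounded_linear_fst
        bounded_linear_compose[OF bounded_bilinear.bounded_linear_left[OF bounded_bilinear_cdot]]
        bounded_linear_compose[OF bounded_linear_mult_left] bounded_linear_snd)
  have inv: "Blinfun e o\<^sub>L Blinfun (d (a, \<zeta>0)) = id_blinfun"
    by (rule blinfun_eqI)
      (simp add: bounded_linear_Blinfun_apply bl ble, simp add: e_def d_def B B_def[symmetric] mult.assoc)
  have oU: "open ((UNIV :: (complex^'n) set) \<times> U)" using U(1) by (intro open_Times) auto
  have aU: "(a, \<zeta>0) \<in> UNIV \<times> U" using U(2) by simp
  obtain N M \<Psi> \<Psi>' where N: "open N" "N \<subseteq> UNIV \<times> U" "(a, \<zeta>0) \<in> N"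
    and M: "open M" "\<Phi> (a, \<zeta>0) \<in> M" and hom: "homeomorphism N M \<Phi> \<Psi>"
    and d\<Psi>: "\<And>y. y \<in> M \<Longrightarrow> (\<Psi> has_derivative \<Psi>' y) (at y)"
    "\<And>y. y \<in> M \<Longrightarrow> \<Psi>' y = inv (blinfun_apply (Blinfun (d (\<Psi> y))))"
    "\<And>y. y \<in> M \<Longrightarrow> bij (blinfun_apply (Blinfun (d (\<Psi> y))))"
    using inverse_function_theorem[OF oU d\<Phi> contd aU inv] by blast
  have \<Phi>a: "\<Phi> (a, \<zeta>0) = (a, 0)" using zero by (simp add: \<Phi>_def F_def)
  obtain W1 V where WV: "open W1" "open V" "a \<in> W1" "\<zeta>0 \<in> V" "W1 \<times> V \<subseteq> N"
    by (rule open_prod_elim[OF N(1,3)]) auto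
  define g where "g = (\<lambda>z. snd (\<Psi> (z, 0)))"
  define W where "W = W1 \<inter> ((\<lambda>z. (z, 0)) -` M \<inter> g -` V)"
  have oM: "open ((\<lambda>z::complex^'n. (z, 0::complex)) -` M)"
    by (intro open_vimage M continuous_intros)
  have dg: "(g has_derivative (\<lambda>v. snd (inv (d (\<Psi> (z, 0))) (v, 0)))) (at z)" if "(z, 0) \<in> M" for z
  proof -
    have "(\<Psi> has_derivative inv (d (\<Psi> (z, 0)))) (at (z, 0))"
      using d\<Psi>(1)[OF that] d\<Psi>(2)[OF that] by (simp add: bounded_linear_Blinfun_apply bl)
    then have "(\<Psi> \<circ> (\<lambda>z. (z, 0)) has_derivative inv (d (\<Psi> (z, 0))) \<circ> (\<lambda>v. (v, 0))) (at z)"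
      by (intro diff_chain_at) (auto intro!: derivative_eq_intros)
    then show ?thesis unfolding g_def o_def by (rule has_derivative_snd)
  qed
  have contg: "continuous_on ((\<lambda>z. (z, 0)) -` M) g"
    using dg by (meson continuous_at_imp_continuous_on has_derivative_continuous vimageD)
  have "open W"
    unfolding W_def using WV(1) continuous_open_preimage[OF contg oM WV(2)] by blast
  moreover have \<Psi>a: "\<Psi> (a, 0) = (a, \<zeta>0)"
    using hom N(3) \<Phi>a by (metis homeomorphism_apply1)
  then have "a \<in> W" using WV M(2) \<Phi>a by (simp add: W_def g_def)
  moreover have "holomorphic_fun_on g W"
    unfolding holomorphic_fun_on_def
  proof
    fix z assume "z \<in> W"
    then have z: "(z, 0) \<in> M" by (simp add: W_def)
    have "bij (d (\<Psi> (z, 0)))" using d\<Psi>(3)[OF z] by (simp add: bounded_linear_Blinfun_apply bl)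
    then have "snd (inv (d (\<Psi> (z, 0))) (c *s v, 0)) = c * snd (inv (d (\<Psi> (z, 0))) (v, 0))" for c v
      by (rule snd_inv_complex_linear) (simp add: d_def cdot_smult_left distrib_left)
    then show "\<exists>L. (g has_derivative L) (at z) \<and> (\<forall>c v. L (c *s v) = c * L v)"
      using dg[OF z] by blast
  qed
  moreover have "(z - k \<zeta>) \<odot> l \<zeta> = 0 \<longleftrightarrow> \<zeta> = g z" if "z \<in> W" "\<zeta> \<in> V" for z \<zeta>
  proof -
    have N\<zeta>: "(z, \<zeta>) \<in> N" and M0: "(z, 0) \<in> M" and gV: "(z, g z) \<in> N"
      using that WV(5) by (auto simp: W_def)
    have "\<Phi> (\<Psi> (z, 0)) = (z, 0)" using hom M0 by (rule homeomorphism_apply2)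
    then have "fst (\<Psi> (z, 0)) = z" and F0: "F z (g z) = 0"
      by (auto simp: \<Phi>_def g_def)
    show ?thesis
    proof
      assume "(z - k \<zeta>) \<odot> l \<zeta> = 0"
      then have "\<Phi> (z, \<zeta>) = (z, 0)" by (simp add: \<Phi>_def F_def)
      then have "\<Psi> (z, 0) = (z, \<zeta>)" using homeomorphism_apply1[OF hom N\<zeta>] by simp
      then show "\<zeta> = g z" by (simp add: g_def)
    qed (use F0 in \<open>simp add: F_def\<close>)
  qed
  moreover have "V \<subseteq> U" using WV(3,5) N(2) by auto
  moreover have "g z \<in> V" if "z \<in> W" for z using that by (simp add: W_def)
  ultimately show thesis using that WV(2,4) by blast
qed

section \<open>Zeros of the family and continuation of the left inverse\<close>

lemma continuous_image_in_closure:
  fixes \<psi> :: "'a::{first_countable_topology,t2_space} \<Rightarrow> 'b::first_countable_topology"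
  assumes "continuous_on U \<psi>" "open U" "x \<in> U" "x \<in> closure S"
  shows "\<psi> x \<in> closure (\<psi> ` (U \<inter> S))"
proof -
  have "x \<in> closure (U \<inter> S)" using assms(2-4) open_Int_closure_subset by blast
  then obtain s where s: "\<And>n. s n \<in> U \<inter> S" "s \<longlonglongrightarrow> x" by (auto simp: closure_sequential)
  have "isCont \<psi> x" using assms(1-3) by (simp add: continuous_on_eq_continuous_at)
  then have "(\<lambda>n. \<psi> (s n)) \<longlonglongrightarrow> \<psi> x" using s(2) by (rule isCont_tendsto_compose)
  moreover have "\<psi> (s n) \<in> \<psi> ` (U \<inter> S)" for n using s(1) by blast
  ultimately show ?thesis unfolding closure_sequential by (intro exI[of _ "\<lambda>n. \<psi> (s n)"]) simp
qed

text \<open>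
  Local data at a point of the closed disc: \<open>U\<close> may reach across the circle, and \<open>k\<close>, \<open>l\<close> continue \<open>f\<close>,
  \<open>h\<close> to it. At points of the open disc one can take \<open>f\<close>, \<open>h\<close> themselves, so that interior and
  boundary zeros can be treated together.
\<close>

definition joint_extension ::
  "(complex \<Rightarrow> complex^'n) \<Rightarrow> (complex \<Rightarrow> complex^'n) \<Rightarrow>
   (complex \<Rightarrow> complex^'n) \<Rightarrow> (complex \<Rightarrow> complex^'n) \<Rightarrow> complex set \<Rightarrow> bool" where
  "joint_extension f h k l U \<longleftrightarrow> open U \<and> holomorphic_curve_on k U \<and> holomorphic_curve_on l U \<and>
     (\<forall>\<zeta>\<in>U \<inter> unit_disc. k \<zeta> = f \<zeta> \<and> l \<zeta> = h \<zeta>)"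

text \<open>
  The situation of the proof in terms of the zeros of \<open>F(z, \<zeta>) = (z - f \<zeta>) \<odot> h \<zeta>\<close>. The condition
  \<open>f' \<odot> h = C \<noteq> 0\<close> makes the zero \<open>\<zeta>\<close> of \<open>F(f \<zeta>, \<cdot>)\<close> simple, because \<open>\<partial>F/\<partial>\<zeta> = - C\<close> at
  \<open>(f \<zeta>, \<zeta>)\<close>; it persists on the circle by continuity and keeps \<open>h\<close> from vanishing there.
\<close>

locale extendable_zero_family =
  fixes D :: "(complex^'n) set" and f h :: "complex \<Rightarrow> complex^'n"
    and G :: "complex^'n \<Rightarrow> complex" and C :: complex
  assumes open_D: "open D"
    and strictly_convex: "\<And>x y. x \<in> closure D \<Longrightarrow> y \<in> closure D \<Longrightarrow> x \<noteq> y \<Longrightarrow> open_segment x y \<subseteq> D"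
    and hol_f: "holomorphic_curve_on f unit_disc"
    and hol_h: "holomorphic_curve_on h unit_disc"
    and f_in: "\<And>\<zeta>. \<zeta> \<in> unit_disc \<Longrightarrow> f \<zeta> \<in> D"
    and cont_G: "continuous_on D G"
    and G_in: "\<And>z. z \<in> D \<Longrightarrow> G z \<in> unit_disc"
    and unique_zero: "\<And>z \<zeta>. z \<in> D \<Longrightarrow> \<zeta> \<in> unit_disc \<Longrightarrow> (z - f \<zeta>) \<odot> h \<zeta> = 0 \<longleftrightarrow> \<zeta> = G z"
    and pairing: "\<And>\<zeta>. \<zeta> \<in> unit_disc \<Longrightarrow> curve_deriv f \<zeta> \<odot> h \<zeta> = C"
    and C_nonzero: "C \<noteq> 0"
    and boundary_extension: "\<And>\<zeta>. norm \<zeta> = 1 \<Longrightarrow> \<exists>k l U. joint_extension f h k l U \<and> \<zeta> \<in> U"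
begin

lemma convex_D: "convex D"
  unfolding convex_contains_segment
proof (intro ballI)
  fix x y assume xy: "x \<in> D" "y \<in> D"
  then show "closed_segment x y \<subseteq> D"
    using strictly_convex[of x y] closure_subset[of D]
    by (cases "x = y") (auto simp: open_segment_def)
qed

lemma extension_pairing:
  assumes ext: "joint_extension f h k l U" and \<zeta>: "\<zeta> \<in> U" "norm \<zeta> \<le> 1"
  shows "curve_deriv k \<zeta> \<odot> l \<zeta> = C"
proof -
  have U: "open U" and k: "holomorphic_curve_on k U" and l: "holomorphic_curve_on l U"
    and eq: "\<And>x. x \<in> U \<inter> unit_disc \<Longrightarrow> k x = f x \<and> l x = h x"
    using ext by (auto simp: joint_extension_def)
  have const: "curve_deriv k x \<odot> l x = C" if x: "x \<in> U \<inter> unit_disc" for x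
  proof -
    have "eventually (\<lambda>y. k y = f y) (nhds x)"
      using x U eq by (intro eventually_nhds[THEN iffD2] exI[of _ "U \<inter> unit_disc"]) auto
    then have "deriv (\<lambda>y. k y $ j) x = deriv (\<lambda>y. f y $ j) x" for j
      by (intro deriv_cong_ev) (auto elim: eventually_mono)
    then have "curve_deriv k x = curve_deriv f x" by (simp add: curve_deriv_def)
    then show ?thesis using eq x pairing by simp
  qed
  have "continuous_on U (\<lambda>x. curve_deriv k x \<odot> l x)"
    using holomorphic_curve_on_curve_deriv[OF k U] k l
    by (intro continuous_intros holomorphic_curve_on_imp_continuous_on)
  then have "curve_deriv k \<zeta> \<odot> l \<zeta> \<in> closure ((\<lambda>x. curve_deriv k x \<odot> l x) ` (U \<inter> unit_disc))"
    using U \<zeta> by (intro continuous_image_in_closure) auto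
  also have "\<dots> \<subseteq> closure {C}" using const by (intro closure_mono) auto
  finally show ?thesis by simp
qed

lemma extension_in_closure:
  assumes ext: "joint_extension f h k l U" and \<zeta>: "\<zeta> \<in> U" "norm \<zeta> \<le> 1"
  shows "k \<zeta> \<in> closure D"
proof -
  have "k \<zeta> \<in> closure (k ` (U \<inter> unit_disc))"
    using ext \<zeta> holomorphic_curve_on_imp_continuous_on
    by (intro continuous_image_in_closure) (auto simp: joint_extension_def)
  also have "\<dots> \<subseteq> closure D" using ext f_in by (intro closure_mono) (auto simp: joint_extension_def)
  finally show ?thesis .
qed

text \<open>
  If \<open>F(z, \<zeta>0) = 0\<close>, choose a direction \<open>v\<close> with \<open>v \<odot> l \<zeta>0 \<noteq> 0\<close>. Since \<open>F\<close> is affine in \<open>z\<close>, the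
  point \<open>z + m \<zeta> v\<close> with \<open>m \<zeta> = - F(z, \<zeta>) / (v \<odot> l \<zeta>)\<close> has \<open>\<zeta>\<close> as a zero, and \<open>m \<zeta>\<close> tends to \<open>0\<close> as
  \<open>\<zeta>\<close> tends to \<open>\<zeta>0\<close>. Hence \<open>G (z + m \<zeta> v) = \<zeta>\<close> for \<open>\<zeta>\<close> in the disc close to \<open>\<zeta>0\<close>, and in the limit
  \<open>G z = \<zeta>0\<close>, which has modulus one.
\<close>

lemma no_zero_on_circle:
  assumes ext: "joint_extension f h k l U" and \<zeta>0: "\<zeta>0 \<in> U" "norm \<zeta>0 = 1" and z: "z \<in> D"
  shows "(z - k \<zeta>0) \<odot> l \<zeta>0 \<noteq> 0"
proof
  assume zero: "(z - k \<zeta>0) \<odot> l \<zeta>0 = 0"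
  have U: "open U" and k: "holomorphic_curve_on k U" and l: "holomorphic_curve_on l U"
    and eq: "\<And>x. x \<in> U \<inter> unit_disc \<Longrightarrow> k x = f x \<and> l x = h x"
    using ext by (auto simp: joint_extension_def)
  have "l \<zeta>0 \<noteq> 0" using extension_pairing[OF ext \<zeta>0(1)] \<zeta>0(2) C_nonzero by auto
  then obtain j where j: "l \<zeta>0 $ j \<noteq> 0" by (auto simp: vec_eq_iff)
  define v where "v = (axis j 1 :: complex^'n)"
  have v: "v \<odot> w = w $ j" for w
    by (simp add: v_def cdot_def axis_def if_distrib[of "\<lambda>x. x * _"] cong: if_cong)
  define m where "m = (\<lambda>\<zeta>. - ((z - k \<zeta>) \<odot> l \<zeta>) / (v \<odot> l \<zeta>))"
  have "\<zeta>0 \<in> closure (U \<inter> unit_disc)"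
    using open_Int_closure_subset[OF U, of unit_disc] \<zeta>0 by auto
  then obtain s where s: "\<And>n. s n \<in> U \<inter> unit_disc" "s \<longlonglongrightarrow> \<zeta>0" by (auto simp: closure_sequential)
  have lim: "(\<lambda>n. k (s n)) \<longlonglongrightarrow> k \<zeta>0" "(\<lambda>n. l (s n)) \<longlonglongrightarrow> l \<zeta>0"
    using k l U \<zeta>0 s(2)
    by (auto dest!: holomorphic_curve_on_imp_continuous_on simp: continuous_on_eq_continuous_at
        intro: isCont_tendsto_compose)
  have limv: "(\<lambda>n. v \<odot> l (s n)) \<longlonglongrightarrow> v \<odot> l \<zeta>0" by (intro tendsto_intros lim)
  have vne: "v \<odot> l \<zeta>0 \<noteq> 0" using j v by simp
  have "(\<lambda>n. m (s n)) \<longlonglongrightarrow> - ((z - k \<zeta>0) \<odot> l \<zeta>0) / (v \<odot> l \<zeta>0)"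
    unfolding m_def by (intro tendsto_intros lim vne)
  then have m0: "(\<lambda>n. m (s n)) \<longlonglongrightarrow> 0" by (simp add: zero)
  have w: "(\<lambda>n. z + m (s n) *s v) \<longlonglongrightarrow> z"
  proof (rule vec_tendstoI)
    fix i
    have "(\<lambda>n. z $ i + m (s n) * v $ i) \<longlonglongrightarrow> z $ i + 0 * v $ i" by (intro tendsto_intros m0)
    then show "(\<lambda>n. (z + m (s n) *s v) $ i) \<longlonglongrightarrow> z $ i" by simp
  qed
  have "isCont G z" using cont_G open_D z by (simp add: continuous_on_eq_continuous_at)
  then have Gw: "(\<lambda>n. G (z + m (s n) *s v)) \<longlonglongrightarrow> G z" using w by (rule isCont_tendsto_compose)
  have "eventually (\<lambda>n. z + m (s n) *s v \<in> D) sequentially" using topological_tendstoD[OF w open_D z] .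
  moreover have "eventually (\<lambda>n. v \<odot> l (s n) \<noteq> 0) sequentially"
    using tendsto_imp_eventually_ne[OF limv vne] .
  ultimately have "eventually (\<lambda>n. G (z + m (s n) *s v) = s n) sequentially"
  proof eventually_elim
    case (elim n)
    have "(z + m (s n) *s v - k (s n)) \<odot> l (s n) = (z - k (s n)) \<odot> l (s n) + m (s n) * (v \<odot> l (s n))"
      by (simp add: cdot_diff_left cdot_add_left cdot_smult_left)
    also have "\<dots> = 0" using elim by (simp add: m_def)
    finally show ?case using unique_zero[OF elim(1), of "s n"] eq[OF s(1)[of n]] s(1)[of n] by simp
  qed
  then have "s \<longlonglongrightarrow> G z" using Gw by (rule Lim_transform_eventually[rotated])
  then have "G z = \<zeta>0" using s(2) LIMSEQ_unique by blast
  then show False using G_in[OF z] \<zeta>0 by simp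
qed

text \<open>
  Otherwise the midpoint of \<open>a\<close> and \<open>k \<zeta>\<close> would be a point of \<open>D\<close> with a zero on the circle.
\<close>

lemma circle_zero_is_curve_point:
  assumes ext: "joint_extension f h k l U" and \<zeta>: "\<zeta> \<in> U" "norm \<zeta> = 1"
    and a: "a \<in> closure D" "(a - k \<zeta>) \<odot> l \<zeta> = 0"
  shows "a = k \<zeta>"
proof (rule ccontr)
  assume ne: "a \<noteq> k \<zeta>"
  have "k \<zeta> \<in> closure D" using extension_in_closure[OF ext] \<zeta> by simp
  then have "midpoint a (k \<zeta>) \<in> D"
    using strictly_convex[OF a(1) _ ne] ne by (auto simp: midpoint_in_open_segment)
  moreover have "midpoint a (k \<zeta>) - k \<zeta> = (1/2) *\<^sub>R (a + k \<zeta>) - (1/2) *\<^sub>R (k \<zeta> + k \<zeta>)"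
    by (simp only: midpoint_def inverse_eq_divide scaleR_half_double)
  then have "midpoint a (k \<zeta>) - k \<zeta> = (1/2) *\<^sub>R (a - k \<zeta>)"
    by (simp only: scaleR_diff_right[symmetric] add_diff_cancel_right)
  then have "(midpoint a (k \<zeta>) - k \<zeta>) \<odot> l \<zeta> = 0" by (simp only: cdot_scaleR_left a(2)) simp
  ultimately show False using no_zero_on_circle[OF ext \<zeta>] by blast
qed

text \<open>
  If \<open>F(a, \<cdot>)\<close> vanished identically, then, by continuity and \<open>circle_zero_is_curve_point\<close>, the extension
  \<open>k\<close> of \<open>f\<close> would be equal to \<open>a\<close> on an arc of the circle. Its derivative would then vanish there,
  in contradiction to \<open>k' \<odot> l = C \<noteq> 0\<close>.
\<close>

lemma zero_equation_not_trivial: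
  assumes a: "a \<in> closure D"
  shows "\<exists>\<zeta>\<in>unit_disc. (a - f \<zeta>) \<odot> h \<zeta> \<noteq> 0"
proof (rule ccontr)
  assume "\<not> ?thesis"
  then have triv: "\<And>\<zeta>. \<zeta> \<in> unit_disc \<Longrightarrow> (a - f \<zeta>) \<odot> h \<zeta> = 0" by blast
  obtain k l U where ext: "joint_extension f h k l U" and one: "1 \<in> U"
    using boundary_extension[of 1] by auto
  have U: "open U" and k: "holomorphic_curve_on k U" and l: "holomorphic_curve_on l U"
    and eq: "\<And>x. x \<in> U \<inter> unit_disc \<Longrightarrow> k x = f x \<and> l x = h x"
    using ext by (auto simp: joint_extension_def)
  have ka: "k \<zeta> = a" if \<zeta>: "\<zeta> \<in> U" "norm \<zeta> = 1" for \<zeta>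
  proof -
    have "continuous_on U (\<lambda>x. (a - k x) \<odot> l x)"
      using k l by (intro continuous_intros holomorphic_curve_on_imp_continuous_on)
    then have "(a - k \<zeta>) \<odot> l \<zeta> \<in> closure ((\<lambda>x. (a - k x) \<odot> l x) ` (U \<inter> unit_disc))"
      using U \<zeta> by (intro continuous_image_in_closure) auto
    also have "\<dots> \<subseteq> closure {0}" using triv eq by (intro closure_mono) auto
    finally show ?thesis using circle_zero_is_curve_point[OF ext \<zeta> a] by simp
  qed
  have "curve_deriv k 1 $ j = 0" for j
  proof -
    have d: "((\<lambda>\<zeta>. k \<zeta> $ j) has_field_derivative curve_deriv k 1 $ j) (at (cis 0))"
      using k U one by (auto simp: holomorphic_curve_on_def curve_deriv_def intro: holomorphic_derivI)
    have dcis: "(cis has_vector_derivative \<i> * cis 0) (at 0)"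
      unfolding cis_conv_exp
      by (rule has_vector_derivative_real_field[of "\<lambda>z. exp (\<i> * z)"])
        (auto intro!: derivative_eq_intros)
    then have 1: "((\<lambda>t. k (cis t) $ j) has_vector_derivative (\<i> * cis 0) * curve_deriv k 1 $ j) (at 0)"
      using field_vector_diff_chain_at[OF dcis d] by (simp add: o_def)
    have "open (cis -` U)" using U by (intro open_vimage) (auto intro!: continuous_intros)
    then have "eventually (\<lambda>t. k (cis t) $ j = a $ j) (nhds 0)"
      using one ka unfolding eventually_nhds by (intro exI[of _ "cis -` U"]) auto
    then have "((\<lambda>t. k (cis t) $ j) has_vector_derivative 0) (at 0)"
      by (subst has_vector_derivative_cong_ev) (auto simp: ka one elim: eventually_mono)
    with 1 have "(\<i> * cis 0) * curve_deriv k 1 $ j = 0" by (rule vector_derivative_unique_at)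
    then show ?thesis by simp
  qed
  then have "curve_deriv k 1 = 0" by (simp add: vec_eq_iff)
  then show False using extension_pairing[OF ext one] C_nonzero by simp
qed

text \<open>
  Compare \<open>q = F(a, \<cdot>)\<close> with \<open>p = F(f \<zeta>0, \<cdot>)\<close>, whose only zero in the disc is the simple zero \<open>\<zeta>0\<close>. If
  \<open>\<zeta>0\<close> is a multiple zero of \<open>q\<close>, then \<open>q / p\<close> is holomorphic with a zero at \<open>\<zeta>0\<close>. By the open mapping
  theorem it takes a value \<open>- s\<close> with \<open>s > 0\<close> at some \<open>\<mu> \<noteq> \<zeta>0\<close>. Then \<open>s p + q\<close> vanishes at both \<open>\<zeta>0\<close>
  and \<open>\<mu>\<close>; up to the factor \<open>1 + s\<close> this is \<open>F(z, \<cdot>)\<close> for a point \<open>z\<close> between \<open>f \<zeta>0\<close> and \<open>a\<close>, which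
  lies in \<open>D\<close>.
\<close>

lemma interior_zero_simple:
  assumes \<zeta>0: "\<zeta>0 \<in> unit_disc" and a: "a \<in> closure D" and zero: "(a - f \<zeta>0) \<odot> h \<zeta>0 = 0"
  shows "(a - f \<zeta>0) \<odot> curve_deriv h \<zeta>0 - curve_deriv f \<zeta>0 \<odot> h \<zeta>0 \<noteq> 0"
proof
  assume double: "(a - f \<zeta>0) \<odot> curve_deriv h \<zeta>0 - curve_deriv f \<zeta>0 \<odot> h \<zeta>0 = 0"
  define p where "p = (\<lambda>\<zeta>. (f \<zeta>0 - f \<zeta>) \<odot> h \<zeta>)"
  define q where "q = (\<lambda>\<zeta>. (a - f \<zeta>) \<odot> h \<zeta>)"
  have hol: "p holomorphic_on unit_disc" "q holomorphic_on unit_disc"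
    unfolding p_def q_def by (intro holomorphic_on_zero_equation hol_f hol_h)+
  have dp: "deriv p \<zeta>0 = - C"
    using has_field_derivative_zero_equation[OF hol_f hol_h _ \<zeta>0, of "f \<zeta>0"] pairing[OF \<zeta>0]
    unfolding p_def by (intro DERIV_imp_deriv) simp
  have dq: "deriv q \<zeta>0 = 0"
    using has_field_derivative_zero_equation[OF hol_f hol_h _ \<zeta>0, of a] double
    unfolding q_def by (intro DERIV_imp_deriv) simp
  have ne: "a \<noteq> f \<zeta>0" using dp dq C_nonzero by (auto simp: p_def q_def)
  have G0: "G (f \<zeta>0) = \<zeta>0" using unique_zero[OF f_in[OF \<zeta>0] \<zeta>0] by simp
  have p0: "p \<zeta> = 0 \<longleftrightarrow> \<zeta> = \<zeta>0" if "\<zeta> \<in> unit_disc" for \<zeta>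
    using unique_zero[OF f_in[OF \<zeta>0] that] by (simp add: p_def G0)
  have q0: "q \<zeta>0 = 0" using zero by (simp add: q_def)
  \<comment> \<open>The quotient \<open>q / p\<close>, with the common zero \<open>\<zeta>0\<close> divided out of both functions.\<close>
  define p1 where "p1 = (\<lambda>\<zeta>. if \<zeta> = \<zeta>0 then deriv p \<zeta>0 else (p \<zeta> - p \<zeta>0) / (\<zeta> - \<zeta>0))"
  define q1 where "q1 = (\<lambda>\<zeta>. if \<zeta> = \<zeta>0 then deriv q \<zeta>0 else (q \<zeta> - q \<zeta>0) / (\<zeta> - \<zeta>0))"
  have hol1: "p1 holomorphic_on unit_disc" "q1 holomorphic_on unit_disc"
    unfolding p1_def q1_def by (intro pole_lemma_open hol open_ball)+
  have p1: "p1 \<zeta> \<noteq> 0" if "\<zeta> \<in> unit_disc" for \<zeta>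
    using p0[OF that] p0[OF \<zeta>0] dp C_nonzero by (auto simp: p1_def)
  define m where "m = (\<lambda>\<zeta>. q1 \<zeta> / p1 \<zeta>)"
  have holm: "m holomorphic_on unit_disc"
    unfolding m_def using hol1 p1 by (intro holomorphic_intros) auto
  have m0: "m \<zeta>0 = 0" by (simp add: m_def q1_def dq)
  have mpq: "m \<zeta> * p \<zeta> = q \<zeta>" if "\<zeta> \<in> unit_disc" for \<zeta>
    using p0[OF that] p0[OF \<zeta>0] q0 by (auto simp: m_def p1_def q1_def field_simps)
  obtain \<zeta>1 where \<zeta>1: "\<zeta>1 \<in> unit_disc" "q \<zeta>1 \<noteq> 0"
    using zero_equation_not_trivial[OF a] by (auto simp: q_def)
  have "\<not> m constant_on unit_disc"
    using mpq[OF \<zeta>1(1)] \<zeta>1 m0 \<zeta>0 unfolding constant_on_def by (metis mult_zero_left)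
  then have "open (m ` unit_disc)"
    using holm by (intro open_mapping_thm[of m unit_disc]) auto
  moreover have "0 \<in> m ` unit_disc" using m0 \<zeta>0 by (metis imageI)
  ultimately obtain e where e: "e > 0" "ball 0 e \<subseteq> m ` unit_disc" by (meson openE)
  define s where "s = e / 2"
  have s: "s > 0" "- of_real s \<in> ball (0::complex) e" using e(1) by (auto simp: s_def)
  then obtain \<mu> where \<mu>: "\<mu> \<in> unit_disc" "m \<mu> = - of_real s" using e(2) by (metis imageE subsetD)
  have \<mu>ne: "\<mu> \<noteq> \<zeta>0" using \<mu> m0 s by auto
  define z where "z = (1 - 1 / (1 + s)) *\<^sub>R f \<zeta>0 + (1 / (1 + s)) *\<^sub>R a"
  have "z \<in> open_segment (f \<zeta>0) a"
    using s ne unfolding in_segment z_def by (intro conjI exI[of _ "1 / (1 + s)"]) auto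
  then have z: "z \<in> D" using strictly_convex[of "f \<zeta>0" a] f_in[OF \<zeta>0] a ne closure_subset by blast
  have F: "(z - f \<zeta>) \<odot> h \<zeta> = (1 - 1 / (1 + s)) *\<^sub>R p \<zeta> + (1 / (1 + s)) *\<^sub>R q \<zeta>" for \<zeta>
    unfolding z_def p_def q_def cdot_diff_left cdot_add_left cdot_scaleR_left
    by (simp add: algebra_simps)
  have "(z - f \<zeta>0) \<odot> h \<zeta>0 = 0" using F[of \<zeta>0] p0[OF \<zeta>0] q0 by simp
  moreover have "(z - f \<mu>) \<odot> h \<mu> = 0"
  proof -
    have "complex_of_real (1 + s) * ((z - f \<mu>) \<odot> h \<mu>) = q \<mu> + complex_of_real s * p \<mu>"
      using F[of \<mu>] s by (simp add: scaleR_conv_of_real field_simps flip: of_real_add)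
    also have "\<dots> = 0" using mpq[OF \<mu>(1), symmetric] by (simp add: \<mu>(2))
    finally show ?thesis using s(1) by (simp del: of_real_add)
  qed
  ultimately show False using unique_zero[OF z \<zeta>0] unique_zero[OF z \<mu>(1)] \<mu>ne by metis
qed

lemma simple_zeros_of_extension:
  assumes "norm \<zeta>0 \<le> 1"
  obtains k l U where "joint_extension f h k l U" "\<zeta>0 \<in> U"
    "\<And>a. a \<in> closure D \<Longrightarrow> (a - k \<zeta>0) \<odot> l \<zeta>0 = 0 \<Longrightarrow>
      (a - k \<zeta>0) \<odot> curve_deriv l \<zeta>0 - curve_deriv k \<zeta>0 \<odot> l \<zeta>0 \<noteq> 0"
proof (cases "norm \<zeta>0 = 1")
  case True
  then obtain k l U where ext: "joint_extension f h k l U" "\<zeta>0 \<in> U"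
    using boundary_extension by blast
  moreover have "(a - k \<zeta>0) \<odot> curve_deriv l \<zeta>0 - curve_deriv k \<zeta>0 \<odot> l \<zeta>0 \<noteq> 0"
    if "a \<in> closure D" "(a - k \<zeta>0) \<odot> l \<zeta>0 = 0" for a
    using circle_zero_is_curve_point[OF ext True that] extension_pairing[OF ext assms] C_nonzero
    by simp
  ultimately show thesis using that by blast
next
  case False
  then have "\<zeta>0 \<in> unit_disc" using assms by simp
  moreover have "joint_extension f h f h unit_disc"
    by (simp add: joint_extension_def hol_f hol_h)
  ultimately show thesis using that interior_zero_simple by blast
qed

lemma left_inverse_extends: "extends_through_boundary holomorphic_fun_on D G"
  unfolding extends_through_boundary_def
proof
  fix a assume "a \<in> frontier D"
  then have a: "a \<in> closure D" by (simp add: frontier_def)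
  then obtain s where s: "\<And>n. s n \<in> D" "s \<longlonglongrightarrow> a" by (auto simp: closure_sequential)
  have "\<forall>n. (G \<circ> s) n \<in> cball 0 1" using G_in s(1) by (simp add: less_imp_le)
  then obtain \<zeta>0 r where \<zeta>0: "\<zeta>0 \<in> cball 0 1" and r: "strict_mono (r :: nat \<Rightarrow> nat)"
    "((G \<circ> s) \<circ> r) \<longlonglongrightarrow> \<zeta>0"
    using compact_cball[of "0::complex" 1] unfolding compact_def by metis
  define z where "z = s \<circ> r"
  have zD: "\<And>n. z n \<in> D" and za: "z \<longlonglongrightarrow> a" and Gz: "(\<lambda>n. G (z n)) \<longlonglongrightarrow> \<zeta>0"
    using s r LIMSEQ_subseq_LIMSEQ[OF s(2) r(1)] by (auto simp: z_def o_def)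
  obtain k l U where ext: "joint_extension f h k l U" and \<zeta>U: "\<zeta>0 \<in> U"
    and simple: "\<And>a. a \<in> closure D \<Longrightarrow> (a - k \<zeta>0) \<odot> l \<zeta>0 = 0 \<Longrightarrow>
      (a - k \<zeta>0) \<odot> curve_deriv l \<zeta>0 - curve_deriv k \<zeta>0 \<odot> l \<zeta>0 \<noteq> 0"
    using \<zeta>0 by (auto intro: simple_zeros_of_extension)
  have U: "open U" and k: "holomorphic_curve_on k U" and l: "holomorphic_curve_on l U"
    and eq: "\<And>x. x \<in> U \<Longrightarrow> x \<in> unit_disc \<Longrightarrow> k x = f x \<and> l x = h x"
    using ext by (auto simp: joint_extension_def)
  have solves: "(w - k (G w)) \<odot> l (G w) = 0" if "w \<in> D" "G w \<in> U" for w
    using unique_zero[OF that(1) G_in[OF that(1)]] eq[OF that(2) G_in[OF that(1)]] by simp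
  have zero: "(a - k \<zeta>0) \<odot> l \<zeta>0 = 0"
  proof -
    have "isCont k \<zeta>0" "isCont l \<zeta>0"
      using k l U \<zeta>U by (auto dest!: holomorphic_curve_on_imp_continuous_on simp: continuous_on_eq_continuous_at)
    then have lim: "(\<lambda>n. (z n - k (G (z n))) \<odot> l (G (z n))) \<longlonglongrightarrow> (a - k \<zeta>0) \<odot> l \<zeta>0"
      using za Gz by (intro tendsto_intros isCont_tendsto_compose[of \<zeta>0 k] isCont_tendsto_compose[of \<zeta>0 l])
    have "eventually (\<lambda>n. (z n - k (G (z n))) \<odot> l (G (z n)) = 0) sequentially"
      using topological_tendstoD[OF Gz U \<zeta>U] by eventually_elim (use solves zD in blast)
    then show ?thesis
      by (rule LIMSEQ_unique[OF lim tendsto_eventually])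
  qed
  obtain W V g where W: "open W" "a \<in> W" and V: "open V" "\<zeta>0 \<in> V" "V \<subseteq> U"
    and g: "holomorphic_fun_on g W" "\<And>z. z \<in> W \<Longrightarrow> g z \<in> V"
    "\<And>z \<zeta>. z \<in> W \<Longrightarrow> \<zeta> \<in> V \<Longrightarrow> (z - k \<zeta>) \<odot> l \<zeta> = 0 \<longleftrightarrow> \<zeta> = g z"
    by (rule implicit_zero_holomorphic[OF U \<zeta>U k l zero simple[OF a zero]]) (rule that)
  obtain e where e: "e > 0" "ball a e \<subseteq> W" using W by (meson openE)
  define B where "B = ball a e"
  have B: "open B" "a \<in> B" "B \<subseteq> W" using e by (auto simp: B_def)
  \<comment> \<open>The zero \<open>g w\<close> cannot leave the disc while \<open>w\<close> moves in \<open>D \<inter> B\<close>, since it would have to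
     cross the circle; and it is in the disc for the points \<open>z n\<close>.\<close>
  have off_circle: "norm (g w) \<noteq> 1" if "w \<in> B \<inter> D" for w
  proof
    assume "norm (g w) = 1"
    moreover have "g w \<in> V" "(w - k (g w)) \<odot> l (g w) = 0" using that B g by auto
    ultimately show False using no_zero_on_circle[OF ext, of "g w" w] V that by auto
  qed
  have "eventually (\<lambda>n. z n \<in> B \<and> G (z n) \<in> V) sequentially"
    using topological_tendstoD[OF za B(1,2)] topological_tendstoD[OF Gz V(1,2)] by eventually_elim simp
  then obtain n where n: "z n \<in> B" "G (z n) \<in> V" by (auto simp: eventually_sequentially)
  have "g (z n) = G (z n)" using solves[OF zD[of n]] g(3)[of "z n" "G (z n)"] n V(3) B(3) by (metis subsetD)
  then have "g (z n) \<in> unit_disc" using G_in[OF zD[of n]] by simp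
  then have meets: "g (z n) \<in> g ` (B \<inter> D) \<inter> unit_disc" using n(1) zD[of n] by blast
  have "continuous_on W g"
    using g(1) unfolding holomorphic_fun_on_def
    by (meson continuous_at_imp_continuous_on has_derivative_continuous)
  moreover have "connected (B \<inter> D)"
    unfolding B_def by (intro convex_connected convex_Int convex_ball convex_D)
  ultimately have "connected (g ` (B \<inter> D))"
    using B by (intro connected_continuous_image) (auto intro: continuous_on_subset)
  then have inside: "g ` (B \<inter> D) \<subseteq> unit_disc"
    using connected_Int_frontier[of "g ` (B \<inter> D)" unit_disc] meets off_circle by fastforce
  have "g w = G w" if "w \<in> B \<inter> D" for w
  proof -
    have gw: "g w \<in> unit_disc" "g w \<in> U" "(w - k (g w)) \<odot> l (g w) = 0"
      using that inside B V g by auto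
    then show ?thesis using eq[of "g w"] unique_zero[of w "g w"] that by simp
  qed
  moreover have "holomorphic_fun_on g B" using g(1) B(3) by (auto simp: holomorphic_fun_on_def)
  ultimately show "\<exists>U k. open U \<and> a \<in> U \<and> holomorphic_fun_on k U \<and> (\<forall>z\<in>U \<inter> D. k z = G z)"
    using B by blast
qed

end

theorem corollary3p3:
  fixes D :: "(complex^'n) set"
    and f h :: "complex \<Rightarrow> complex^'n"
    and G :: "complex^'n \<Rightarrow> complex"
  assumes "strongly_convex_domain D"
    and "complex_geodesic D f"
    and "normalized_dual D f h"
    and "extends_through_boundary holomorphic_curve_on unit_disc f"
    and "extends_through_boundary holomorphic_curve_on unit_disc h"
    and "corresponding_Lempert_left_inverse D f h G"
  shows "extends_through_boundary holomorphic_fun_on D G"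
proof -
  obtain G1 C where G1: "left_inverse_to D f G1" and hardy: "Hardy1 h"
    and C: "C > 0" "\<And>\<zeta>. \<zeta> \<in> unit_disc \<Longrightarrow> h \<zeta> = C *\<^sub>R cgrad G1 (f \<zeta>)"
    using assms(3) unfolding normalized_dual_def dual_via_def by blast
  have f: "holomorphic_curve_on f unit_disc" "\<And>\<zeta>. \<zeta> \<in> unit_disc \<Longrightarrow> f \<zeta> \<in> D"
    using assms(2) by (auto simp: complex_geodesic_def)
  have G: "left_inverse_to D f G"
    and iff: "\<And>z \<zeta>. z \<in> D \<Longrightarrow> \<zeta> \<in> unit_disc \<Longrightarrow> (z - f \<zeta>) \<odot> h \<zeta> = 0 \<longleftrightarrow> \<zeta> = G z"
    using assms(6) by (auto simp: corresponding_Lempert_left_inverse_def Lempert_left_inverse_def)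
  interpret extendable_zero_family D f h G "complex_of_real C"
  proof
    show "open D" using assms(1) by (simp add: strongly_convex_domain_def)
    show "open_segment x y \<subseteq> D" if "x \<in> closure D" "y \<in> closure D" "x \<noteq> y" for x y
      using strongly_convex_domain_strictly_convex[OF assms(1) that] .
    show "holomorphic_curve_on f unit_disc" "\<And>\<zeta>. \<zeta> \<in> unit_disc \<Longrightarrow> f \<zeta> \<in> D" by (fact f)+
    show "holomorphic_curve_on h unit_disc" using hardy by (simp add: Hardy1_def)
    show "continuous_on D G"
      using G unfolding left_inverse_to_def holomorphic_fun_on_def
      by (meson continuous_at_imp_continuous_on has_derivative_continuous)
    show "G z \<in> unit_disc" if "z \<in> D" for z using G that unfolding left_inverse_to_def by blast
    show "(z - f \<zeta>) \<odot> h \<zeta> = 0 \<longleftrightarrow> \<zeta> = G z" if "z \<in> D" "\<zeta> \<in> unit_disc" for z \<zeta>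
      by (fact iff[OF that])
    show "complex_of_real C \<noteq> 0" using C(1) by simp
    show "curve_deriv f \<zeta> \<odot> h \<zeta> = complex_of_real C" if \<zeta>: "\<zeta> \<in> unit_disc" for \<zeta>
    proof -
      have "((\<lambda>\<zeta>. G1 (f \<zeta>)) has_field_derivative curve_deriv f \<zeta> \<odot> cgrad G1 (f \<zeta>)) (at \<zeta>)"
        using G1 f \<zeta> by (intro chain_rule_cgrad[of f unit_disc \<zeta> G1 D]) (auto simp: left_inverse_to_def)
      then have "((\<lambda>\<zeta>. \<zeta>) has_field_derivative curve_deriv f \<zeta> \<odot> cgrad G1 (f \<zeta>)) (at \<zeta>)"
        by (rule has_field_derivative_transform_within_open[of _ _ _ unit_disc])
          (use G1 \<zeta> in \<open>auto simp: left_inverse_to_def\<close>)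
      then have "curve_deriv f \<zeta> \<odot> cgrad G1 (f \<zeta>) = 1" using DERIV_ident DERIV_unique by blast
      then show ?thesis by (simp add: C(2)[OF \<zeta>] cdot_scaleR_right of_real_def)
    qed
    show "\<exists>k l U. joint_extension f h k l U \<and> \<zeta> \<in> U" if "norm \<zeta> = 1" for \<zeta> :: complex
    proof -
      have "\<zeta> \<in> frontier unit_disc" using that by simp
      then obtain U k V l where "open U" "\<zeta> \<in> U" "holomorphic_curve_on k U" "\<forall>z\<in>U \<inter> unit_disc. k z = f z"
        "open V" "\<zeta> \<in> V" "holomorphic_curve_on l V" "\<forall>z\<in>V \<inter> unit_disc. l z = h z"
        using assms(4,5) unfolding extends_through_boundary_def by meson
      then have "joint_extension f h k l (U \<inter> V)" "\<zeta> \<in> U \<inter> V"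
        by (auto simp: joint_extension_def holomorphic_curve_on_def intro: holomorphic_on_subset)
      then show ?thesis by blast
    qed
  qed
  show ?thesis by (rule left_inverse_extends)
qed

end
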